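(* Let $a,b,c$ be nonzero real numbers and let $\epsilon_0,d,m,w$ be positive real numbers with $mc^2\neq1$ and $mc\neq d$, and suppose that $$a=\frac{\epsilon_0}{mc^2-1},\qquad b=\frac{(c^2m^2-d^2-2m+2mcd)\,w}{2(mc^2-1)}.$$ Set $$\lambda_1=\frac{mw-b}{8a},\qquad \lambda_2=\frac{b-mw}{8\epsilon_0},\qquad \lambda_3=\frac{4\epsilon_0}{(mc-d)w},\qquad \Omega(x,y)=\lambda_1x^2+\lambda_2y^2+1.$$ Then the time-independent functions $$\psi(x,y,t)=\frac{1}{\Omega(x,y)},\qquad \varphi(x,y,t)=\lambda_3\,\frac{\partial_y\Omega(x,y)}{\Omega(x,y)}$$ are a (stationary) solution, wherever $\Omega\neq0$, of the Benney--Roskes/Zakharov--Rubenchik system $$\begin{aligned} &i\psi_t+a\psi_{xx}+\epsilon_0\psi_{yy}=(b-wm)|\psi|^2\psi-w\,\psi\,\Big\{m\tfrac{\partial}{\partial t}+(mc-d)\tfrac{\partial}{\partial y}\Big\}\varphi,\\ &\varphi_{xx}+(1-mc^2)\varphi_{yy}-m\varphi_{tt}-2mc\,\varphi_{yt}=\Big\{m\tfrac{\partial}{\partial t}+(mc-d)\tfrac{\partial}{\partial y}\Big\}|\psi|^2 . \end{aligned}$$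
   Context: Here $\psi$ is (in general) complex-valued and $\varphi$ real-valued, both functions of $(x,y,t)$; all objects are introduced in the claim. *)

theory Defs
  imports "HOL-Analysis.Analysis"
begin

text \<open>Functions of \<open>(x, y, t)\<close> are curried. The partial derivatives are vector derivatives, so
  that they apply to both real- and complex-valued functions of real variables.\<close>

definition pdx :: "(real \<Rightarrow> real \<Rightarrow> real \<Rightarrow> 'a::real_normed_vector) \<Rightarrow> real \<Rightarrow> real \<Rightarrow> real \<Rightarrow> 'a" where
  "pdx u x y t = vector_derivative (\<lambda>s. u s y t) (at x)"

definition pdy :: "(real \<Rightarrow> real \<Rightarrow> real \<Rightarrow> 'a::real_normed_vector) \<Rightarrow> real \<Rightarrow> real \<Rightarrow> real \<Rightarrow> 'a" where
  "pdy u x y t = vector_derivative (\<lambda>s. u x s t) (at y)"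

definition pdt :: "(real \<Rightarrow> real \<Rightarrow> real \<Rightarrow> 'a::real_normed_vector) \<Rightarrow> real \<Rightarrow> real \<Rightarrow> real \<Rightarrow> 'a" where
  "pdt u x y t = vector_derivative (\<lambda>s. u x y s) (at t)"

definition C1_on :: "(real \<times> real \<times> real) set \<Rightarrow>
    (real \<Rightarrow> real \<Rightarrow> real \<Rightarrow> 'a::real_normed_vector) \<Rightarrow> bool" where
  "C1_on D u \<longleftrightarrow>
     (\<forall>(x, y, t) \<in> D. (\<lambda>s. u s y t) differentiable (at x) \<and>
                      (\<lambda>s. u x s t) differentiable (at y) \<and>
                      (\<lambda>s. u x y s) differentiable (at t)) \<and>
     continuous_on D (\<lambda>(x, y, t). pdx u x y t) \<and>
     continuous_on D (\<lambda>(x, y, t). pdy u x y t) \<and>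
     continuous_on D (\<lambda>(x, y, t). pdt u x y t)"

definition C2_on :: "(real \<times> real \<times> real) set \<Rightarrow>
    (real \<Rightarrow> real \<Rightarrow> real \<Rightarrow> 'a::real_normed_vector) \<Rightarrow> bool" where
  "C2_on D u \<longleftrightarrow> C1_on D u \<and> C1_on D (pdx u) \<and> C1_on D (pdy u) \<and> C1_on D (pdt u)"

definition transport_op :: "real \<Rightarrow> real \<Rightarrow> real \<Rightarrow> (real \<Rightarrow> real \<Rightarrow> real \<Rightarrow> real) \<Rightarrow>
    real \<Rightarrow> real \<Rightarrow> real \<Rightarrow> real" where
  "transport_op m c d f x y t = m * pdt f x y t + (m * c - d) * pdy f x y t"

text \<open>Classical solutions of the Benney--Roskes/Zakharov--Rubenchik system on an open set of
  space-time. The explicit regularity requirement is essential, since \<open>vector_derivative\<close> is a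
  total function with an unspecified value where no derivative exists.\<close>

definition BR_ZR_solution_on ::
    "(real \<times> real \<times> real) set \<Rightarrow> real \<Rightarrow> real \<Rightarrow> real \<Rightarrow> real \<Rightarrow> real \<Rightarrow> real \<Rightarrow> real \<Rightarrow>
     (real \<Rightarrow> real \<Rightarrow> real \<Rightarrow> complex) \<Rightarrow> (real \<Rightarrow> real \<Rightarrow> real \<Rightarrow> real) \<Rightarrow> bool" where
  "BR_ZR_solution_on D a b c \<epsilon> d m w \<psi> \<phi> \<longleftrightarrow>
     open D \<and> C2_on D \<psi> \<and> C2_on D \<phi> \<and>
     (\<forall>(x, y, t) \<in> D.
        \<i> * pdt \<psi> x y t + of_real a * pdx (pdx \<psi>) x y t + of_real \<epsilon> * pdy (pdy \<psi>) x y t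
          = of_real (b - w * m) * of_real ((cmod (\<psi> x y t))\<^sup>2) * \<psi> x y t
            - of_real w * \<psi> x y t * of_real (transport_op m c d \<phi> x y t) \<and>
        pdx (pdx \<phi>) x y t + (1 - m * c\<^sup>2) * pdy (pdy \<phi>) x y t
            - m * pdt (pdt \<phi>) x y t - 2 * m * c * pdt (pdy \<phi>) x y t
          = transport_op m c d (\<lambda>x y t. (cmod (\<psi> x y t))\<^sup>2) x y t)"

end

theory Submission
  imports Defs
begin

text \<open>Write \<open>k = \<epsilon>\<^sub>0 l2 = - a l1\<close>. The quotients collapse because the parameters give
  \<open>b - w m = 8 k\<close>, \<open>l1 = (1 - m c\<^sup>2) l2\<close>, \<open>w (m c - d) l3 = 4 \<epsilon>\<^sub>0\<close> and
  \<open>4 (1 - m c\<^sup>2) l2 l3 = m c - d\<close>. The last identity is the only place where the formula for \<open>b\<close>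
  enters: it says that \<open>b - m w = w (m c - d)\<^sup>2 / (2 (1 - m c\<^sup>2))\<close>. With them, both sides of the
  first equation equal \<open>8 k (l2 y\<^sup>2 - l1 x\<^sup>2) / \<Omega>\<^sup>3\<close>, and both sides of the second equal
  \<open>- 4 (m c - d) l2 y / \<Omega>\<^sup>3\<close>.\<close>

text \<open>Explicit candidates for the three partials are carried along, so that a single fact
  yields both the \<open>C1_on\<close> regularity and the values of \<open>pdx\<close>,
  \<open>pdy\<close>, \<open>pdt\<close>.\<close>

definition has_partials_on :: "(real \<times> real \<times> real) set \<Rightarrow>
    (real \<Rightarrow> real \<Rightarrow> real \<Rightarrow> 'a::real_normed_vector) \<Rightarrow> (real \<Rightarrow> real \<Rightarrow> real \<Rightarrow> 'a) \<Rightarrow>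
    (real \<Rightarrow> real \<Rightarrow> real \<Rightarrow> 'a) \<Rightarrow> (real \<Rightarrow> real \<Rightarrow> real \<Rightarrow> 'a) \<Rightarrow> bool" where
  "has_partials_on D u ux uy ut \<longleftrightarrow>
     (\<forall>x y t. (x, y, t) \<in> D \<longrightarrow>
        ((\<lambda>s. u s y t) has_vector_derivative ux x y t) (at x) \<and>
        ((\<lambda>s. u x s t) has_vector_derivative uy x y t) (at y) \<and>
        ((\<lambda>s. u x y s) has_vector_derivative ut x y t) (at t)) \<and>
     continuous_on D (\<lambda>(x, y, t). ux x y t) \<and>
     continuous_on D (\<lambda>(x, y, t). uy x y t) \<and>
     continuous_on D (\<lambda>(x, y, t). ut x y t)"

lemma has_partials_on_pd:
  assumes "has_partials_on D u ux uy ut" and "(x, y, t) \<in> D"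
  shows "pdx u x y t = ux x y t" and "pdy u x y t = uy x y t" and "pdt u x y t = ut x y t"
  using assms unfolding has_partials_on_def pdx_def pdy_def pdt_def
  by (blast intro: vector_derivative_at)+

lemma has_partials_on_C1_on:
  assumes "has_partials_on D u ux uy ut"
  shows "C1_on D u"
proof -
  have "continuous_on D (\<lambda>(x, y, t). pdx u x y t) \<longleftrightarrow> continuous_on D (\<lambda>(x, y, t). ux x y t)"
    "continuous_on D (\<lambda>(x, y, t). pdy u x y t) \<longleftrightarrow> continuous_on D (\<lambda>(x, y, t). uy x y t)"
    "continuous_on D (\<lambda>(x, y, t). pdt u x y t) \<longleftrightarrow> continuous_on D (\<lambda>(x, y, t). ut x y t)"
    by (intro continuous_on_cong; auto simp: has_partials_on_pd[OF assms])+
  then show ?thesis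
    using assms unfolding has_partials_on_def C1_on_def
    by (auto intro: differentiableI_vector)
qed

text \<open>A derivative along a coordinate line depends only on values near the point. Slices of
  the open set \<open>D\<close> are open, so agreement on \<open>D\<close> suffices, whatever
  happens outside.\<close>

lemma has_partials_on_cong:
  assumes "open D" and "has_partials_on D u ux uy ut"
    and eq: "\<And>x y t. (x, y, t) \<in> D \<Longrightarrow> u x y t = v x y t"
  shows "has_partials_on D v ux uy ut"
  unfolding has_partials_on_def
proof (intro conjI allI impI)
  fix x y t
  assume p: "(x, y, t) \<in> D"
  have op: "open ((\<lambda>s. (s, y, t)) -` D)" "open ((\<lambda>s. (x, s, t)) -` D)" "open ((\<lambda>s. (x, y, s)) -` D)"
    by (intro open_vimage \<open>open D\<close> continuous_intros)+
  show "((\<lambda>s. v s y t) has_vector_derivative ux x y t) (at x)"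
    by (rule has_vector_derivative_transform_within_open[OF _ op(1), of "\<lambda>s. u s y t"])
      (use assms(2) p eq in \<open>auto simp: has_partials_on_def\<close>)
  show "((\<lambda>s. v x s t) has_vector_derivative uy x y t) (at y)"
    by (rule has_vector_derivative_transform_within_open[OF _ op(2), of "\<lambda>s. u x s t"])
      (use assms(2) p eq in \<open>auto simp: has_partials_on_def\<close>)
  show "((\<lambda>s. v x y s) has_vector_derivative ut x y t) (at t)"
    by (rule has_vector_derivative_transform_within_open[OF _ op(3), of "\<lambda>s. u x y s"])
      (use assms(2) p eq in \<open>auto simp: has_partials_on_def\<close>)
qed (use assms(2) in \<open>auto simp: has_partials_on_def\<close>)

text \<open>Passage to second derivatives: \<open>pdx u\<close> is known to equal \<open>ux\<close>
  only on \<open>D\<close>, and the congruence transfers the partials of the explicit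
  \<open>ux\<close> to it.\<close>

lemma has_partials_on_pd_has_partials_on:
  assumes "open D" and "has_partials_on D u ux uy ut"
  shows "has_partials_on D ux uxx uxy uxt \<Longrightarrow> has_partials_on D (pdx u) uxx uxy uxt"
    and "has_partials_on D uy uyx uyy uyt \<Longrightarrow> has_partials_on D (pdy u) uyx uyy uyt"
    and "has_partials_on D ut utx uty utt \<Longrightarrow> has_partials_on D (pdt u) utx uty utt"
  by (erule has_partials_on_cong[OF assms(1)]; simp add: has_partials_on_pd[OF assms(2)])+

lemma has_partials_on_C2_on:
  assumes "open D" and "has_partials_on D u ux uy ut"
    and "has_partials_on D ux uxx uxy uxt"
    and "has_partials_on D uy uyx uyy uyt"
    and "has_partials_on D ut utx uty utt"
  shows "C2_on D u"
  unfolding C2_on_def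
  using assms has_partials_on_pd_has_partials_on[OF assms(1,2)] has_partials_on_C1_on by blast

lemma has_partials_on_of_real:
  assumes "has_partials_on D u ux uy ut"
  shows "has_partials_on D (\<lambda>x y t. complex_of_real (u x y t)) (\<lambda>x y t. of_real (ux x y t))
           (\<lambda>x y t. of_real (uy x y t)) (\<lambda>x y t. of_real (ut x y t))"
  using assms unfolding has_partials_on_def case_prod_beta
  by (auto simp: has_real_derivative_iff_has_vector_derivative
      intro!: has_vector_derivative_of_real continuous_on_of_real)

lemma has_partials_on_zero: "has_partials_on D (\<lambda>x y t. 0) (\<lambda>x y t. 0) (\<lambda>x y t. 0) (\<lambda>x y t. 0)"
  by (simp add: has_partials_on_def case_prod_beta)

text \<open>Leaves only real derivatives in x and y to be checked, in the form that
  \<open>derivative_eq_intros\<close> handles.\<close>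

lemma stationary_has_partials_onI:
  fixes u :: "real \<Rightarrow> real \<Rightarrow> real"
  assumes "\<And>x y t. (x, y, t) \<in> D \<Longrightarrow> ((\<lambda>s. u s y) has_real_derivative ux x y) (at x)"
    and "\<And>x y t. (x, y, t) \<in> D \<Longrightarrow> ((\<lambda>s. u x s) has_real_derivative uy x y) (at y)"
    and "continuous_on D (\<lambda>p. ux (fst p) (fst (snd p)))"
    and "continuous_on D (\<lambda>p. uy (fst p) (fst (snd p)))"
  shows "has_partials_on D (\<lambda>x y t. u x y) (\<lambda>x y t. ux x y) (\<lambda>x y t. uy x y) (\<lambda>x y t. 0)"
  using assms unfolding has_partials_on_def case_prod_beta
  by (auto simp: has_real_derivative_iff_has_vector_derivative)

theorem mainTheorem6:
  fixes a b c \<epsilon>\<^sub>0 d m w l1 l2 l3 :: real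
    and \<Omega> :: "real \<Rightarrow> real \<Rightarrow> real"
    and \<psi> :: "real \<Rightarrow> real \<Rightarrow> real \<Rightarrow> complex"
    and \<phi> :: "real \<Rightarrow> real \<Rightarrow> real \<Rightarrow> real"
  assumes "a \<noteq> 0" and "b \<noteq> 0" and "c \<noteq> 0"
    and "\<epsilon>\<^sub>0 > 0" and "d > 0" and "m > 0" and "w > 0"
    and "m * c\<^sup>2 \<noteq> 1" and "m * c \<noteq> d"
    and "a = \<epsilon>\<^sub>0 / (m * c\<^sup>2 - 1)"
    and "b = (c\<^sup>2 * m\<^sup>2 - d\<^sup>2 - 2 * m + 2 * m * c * d) * w / (2 * (m * c\<^sup>2 - 1))"
    and "l1 = (m * w - b) / (8 * a)"
    and "l2 = (b - m * w) / (8 * \<epsilon>\<^sub>0)"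
    and "l3 = 4 * \<epsilon>\<^sub>0 / ((m * c - d) * w)"
    and "\<Omega> = (\<lambda>x y. l1 * x\<^sup>2 + l2 * y\<^sup>2 + 1)"
    and "\<psi> = (\<lambda>x y t. complex_of_real (1 / \<Omega> x y))"
    and "\<phi> = (\<lambda>x y t. l3 * (deriv (\<lambda>s. \<Omega> x s) y / \<Omega> x y))"
  shows "BR_ZR_solution_on {(x, y, t). \<Omega> x y \<noteq> 0} a b c \<epsilon>\<^sub>0 d m w \<psi> \<phi>"
proof -
  note defs = \<open>l1 = _\<close> \<open>l2 = _\<close> \<open>l3 = _\<close>
  define D where "D = {(x, y, t :: real). \<Omega> x y \<noteq> 0}"
  \<comment> \<open>Since the y-derivative of \<open>\<Omega>\<close> is \<open>2 * l2 * y\<close>,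
    this makes \<open>\<phi>\<close> equal to \<open>K * y / \<Omega> x y\<close>.\<close>
  define K where "K = 2 * l2 * l3"

  have nz: "\<Omega> x y \<noteq> 0" if "(x, y, t) \<in> D" for x y t
    using that by (simp add: D_def)
  \<comment> \<open>With these rules \<open>\<Omega>\<close> stays opaque under differentiation, and
    all denominators below are powers of it.\<close>
  have \<Omega>_x [derivative_intros]: "((\<lambda>s. \<Omega> s y) has_real_derivative 2 * l1 * x) (at x)" for x y
    unfolding \<open>\<Omega> = _\<close> by (auto intro!: derivative_eq_intros)
  have \<Omega>_y [derivative_intros]: "((\<lambda>s. \<Omega> x s) has_real_derivative 2 * l2 * y) (at y)" for x y
    unfolding \<open>\<Omega> = _\<close> by (auto intro!: derivative_eq_intros)
  have \<Omega>_cont [continuous_intros]: "continuous_on S (\<lambda>p. \<Omega> (fst p) (fst (snd p)))"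
    for S :: "(real \<times> real \<times> real) set"
    unfolding \<open>\<Omega> = _\<close> by (intro continuous_intros)
  have "open D"
    unfolding D_def case_prod_beta by (intro open_Collect_neq continuous_intros)

  have \<psi>_eq: "\<psi> = (\<lambda>x y t. complex_of_real (1 / \<Omega> x y))"
    by fact
  have \<phi>_eq: "\<phi> = (\<lambda>x y t. K * y / \<Omega> x y)"
    unfolding \<open>\<phi> = _\<close> K_def by (simp add: DERIV_imp_deriv[OF \<Omega>_y] algebra_simps)

  \<comment> \<open>Quotient-rule computations. The mixed partials are listed too, because
    \<open>C2_on\<close> asks for every first partial to be \<open>C1_on\<close>.\<close>
  have real_psi: "has_partials_on D (\<lambda>x y t. 1 / \<Omega> x y)
      (\<lambda>x y t. - 2 * l1 * x / (\<Omega> x y)^2)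
      (\<lambda>x y t. - 2 * l2 * y / (\<Omega> x y)^2)
      (\<lambda>x y t. 0)"
    by (rule stationary_has_partials_onI; (intro continuous_intros)?)
      (auto dest: nz intro!: derivative_eq_intros simp: field_simps power2_eq_square power3_eq_cube)
  have real_psi_x: "has_partials_on D (\<lambda>x y t. - 2 * l1 * x / (\<Omega> x y)^2)
      (\<lambda>x y t. - 2 * l1 / (\<Omega> x y)^2 + 8 * l1^2 * x^2 / (\<Omega> x y)^3)
      (\<lambda>x y t. 8 * l1 * l2 * x * y / (\<Omega> x y)^3)
      (\<lambda>x y t. 0)"
    by (rule stationary_has_partials_onI; (intro continuous_intros)?)
      (auto dest: nz intro!: derivative_eq_intros simp: field_simps power2_eq_square power3_eq_cube)
  have real_psi_y: "has_partials_on D (\<lambda>x y t. - 2 * l2 * y / (\<Omega> x y)^2)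
      (\<lambda>x y t. 8 * l1 * l2 * x * y / (\<Omega> x y)^3)
      (\<lambda>x y t. - 2 * l2 / (\<Omega> x y)^2 + 8 * l2^2 * y^2 / (\<Omega> x y)^3)
      (\<lambda>x y t. 0)"
    by (rule stationary_has_partials_onI; (intro continuous_intros)?)
      (auto dest: nz intro!: derivative_eq_intros simp: field_simps power2_eq_square power3_eq_cube)
  have phi: "has_partials_on D (\<lambda>x y t. K * y / \<Omega> x y)
      (\<lambda>x y t. - 2 * K * l1 * x * y / (\<Omega> x y)^2)
      (\<lambda>x y t. K / \<Omega> x y - 2 * K * l2 * y^2 / (\<Omega> x y)^2)
      (\<lambda>x y t. 0)"
    by (rule stationary_has_partials_onI; (intro continuous_intros)?)
      (auto dest: nz intro!: derivative_eq_intros simp: field_simps power2_eq_square power3_eq_cube)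
  have phi_x: "has_partials_on D (\<lambda>x y t. - 2 * K * l1 * x * y / (\<Omega> x y)^2)
      (\<lambda>x y t. - 2 * K * l1 * y / (\<Omega> x y)^2 + 8 * K * l1^2 * x^2 * y / (\<Omega> x y)^3)
      (\<lambda>x y t. - 2 * K * l1 * x / (\<Omega> x y)^2 + 8 * K * l1 * l2 * x * y^2 / (\<Omega> x y)^3)
      (\<lambda>x y t. 0)"
    by (rule stationary_has_partials_onI; (intro continuous_intros)?)
      (auto dest: nz intro!: derivative_eq_intros simp: field_simps power2_eq_square power3_eq_cube)
  have phi_y: "has_partials_on D (\<lambda>x y t. K / \<Omega> x y - 2 * K * l2 * y^2 / (\<Omega> x y)^2)
      (\<lambda>x y t. - 2 * K * l1 * x / (\<Omega> x y)^2 + 8 * K * l1 * l2 * x * y^2 / (\<Omega> x y)^3)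
      (\<lambda>x y t. - 6 * K * l2 * y / (\<Omega> x y)^2 + 8 * K * l2^2 * y^3 / (\<Omega> x y)^3)
      (\<lambda>x y t. 0)"
    by (rule stationary_has_partials_onI; (intro continuous_intros)?)
      (auto dest: nz intro!: derivative_eq_intros simp: field_simps power2_eq_square power3_eq_cube)
  have psi_sq: "has_partials_on D (\<lambda>x y t. 1 / (\<Omega> x y)^2)
      (\<lambda>x y t. - 4 * l1 * x / (\<Omega> x y)^3)
      (\<lambda>x y t. - 4 * l2 * y / (\<Omega> x y)^3)
      (\<lambda>x y t. 0)"
    by (rule stationary_has_partials_onI; (intro continuous_intros)?)
      (auto dest: nz intro!: derivative_eq_intros simp: field_simps power2_eq_square power3_eq_cube)
  note psi = has_partials_on_of_real[OF real_psi, folded \<psi>_eq]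
    and psi_x = has_partials_on_of_real[OF real_psi_x]
    and psi_y = has_partials_on_of_real[OF real_psi_y]
    and psi_t = has_partials_on_of_real[OF has_partials_on_zero]
  note phi = phi[folded \<phi>_eq]
  \<comment> \<open>An equality of functions, since \<open>transport_op\<close> differentiates the
    squared modulus.\<close>
  have cmod_sq: "(\<lambda>x y t. (cmod (\<psi> x y t))\<^sup>2) = (\<lambda>x y t. 1 / (\<Omega> x y)^2)"
    unfolding \<psi>_eq by (simp add: norm_divide power_divide)
  note pd = has_partials_on_pd_has_partials_on[OF \<open>open D\<close>]
  note vals = has_partials_on_pd[OF psi] has_partials_on_pd[OF phi]
    has_partials_on_pd[OF psi_sq]
    has_partials_on_pd[OF pd(1)[OF psi psi_x]] has_partials_on_pd[OF pd(2)[OF psi psi_y]]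
    has_partials_on_pd[OF pd(1)[OF phi phi_x]] has_partials_on_pd[OF pd(2)[OF phi phi_y]]
    has_partials_on_pd[OF pd(3)[OF phi has_partials_on_zero]]

  have "m * c\<^sup>2 - 1 \<noteq> 0" "m * c - d \<noteq> 0" "w \<noteq> 0" "\<epsilon>\<^sub>0 \<noteq> 0"
    using assms by auto
  have k2: "b - w * m = 8 * \<epsilon>\<^sub>0 * l2" and k1: "a * l1 = - \<epsilon>\<^sub>0 * l2"
    using \<open>a \<noteq> 0\<close> \<open>\<epsilon>\<^sub>0 \<noteq> 0\<close> unfolding defs by (simp_all add: field_simps)
  have l1_l2: "l1 = (1 - m * c\<^sup>2) * l2"
  proof -
    have "a * (m * c\<^sup>2 - 1) = \<epsilon>\<^sub>0"
      using \<open>a = _\<close> \<open>m * c\<^sup>2 - 1 \<noteq> 0\<close> by simp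
    with k1 have "\<epsilon>\<^sub>0 * l1 = \<epsilon>\<^sub>0 * ((1 - m * c\<^sup>2) * l2)"
      by algebra
    then show ?thesis
      using \<open>\<epsilon>\<^sub>0 \<noteq> 0\<close> by simp
  qed
  have l3: "w * (m * c - d) * l3 = 4 * \<epsilon>\<^sub>0"
    using \<open>m * c - d \<noteq> 0\<close> \<open>w \<noteq> 0\<close> unfolding defs by simp
  \<comment> \<open>Subtracting \<open>2 * w * m * (m * c\<^sup>2 - 1)\<close> from the numerator of
    \<open>b\<close> cancels \<open>- 2 * m\<close> and turns \<open>c\<^sup>2 * m\<^sup>2\<close>
    into its negative, which leaves \<open>- w * (m * c - d)\<^sup>2\<close>.\<close>
  have "2 * (1 - m * c\<^sup>2) * (b - w * m) = w * (m * c - d)\<^sup>2"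
  proof -
    have "b * (2 * (m * c\<^sup>2 - 1)) = (c\<^sup>2 * m\<^sup>2 - d\<^sup>2 - 2 * m + 2 * m * c * d) * w"
      using \<open>b = _\<close> \<open>m * c\<^sup>2 - 1 \<noteq> 0\<close> by simp
    then show ?thesis
      by algebra
  qed
  then have "4 * (1 - m * c\<^sup>2) * l2 * (4 * \<epsilon>\<^sub>0) = w * (m * c - d)\<^sup>2"
    unfolding k2 by (simp add: algebra_simps)
  \<comment> \<open>Writing \<open>4 * \<epsilon>\<^sub>0\<close> as
    \<open>w * (m * c - d) * l3\<close> exposes a nonzero common factor to cancel.\<close>
  then have "w * (m * c - d) * (4 * (1 - m * c\<^sup>2) * l2 * l3) = w * (m * c - d) * (m * c - d)"
    unfolding l3[symmetric] by (simp add: power2_eq_square algebra_simps)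
  then have l2_l3: "4 * (1 - m * c\<^sup>2) * l2 * l3 = m * c - d"
    using \<open>m * c - d \<noteq> 0\<close> \<open>w \<noteq> 0\<close> by (metis mult_cancel_left mult_eq_0_iff)

  \<comment> \<open>\<open>W\<close> stands for the value of \<open>\<Omega>\<close>, so that
    multiplying by \<open>W^3\<close> leaves a polynomial identity.\<close>
  have first_eq: "a * (- 2 * l1 / W^2 + 8 * l1^2 * x^2 / W^3) + \<epsilon>\<^sub>0 * (- 2 * l2 / W^2 + 8 * l2^2 * y^2 / W^3)
      = (b - w * m) * (1 / W^2) * (1 / W)
        - w * (1 / W) * ((m * c - d) * (K / W - 2 * K * l2 * y^2 / W^2))"
    if W: "W = l1 * x\<^sup>2 + l2 * y\<^sup>2 + 1" and "W \<noteq> 0" for x y W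
  proof -
    \<comment> \<open>On the left the terms in \<open>W\<close> cancel by \<open>k1\<close>. On the
      right \<open>w * (m * c - d) * K = 8 * \<epsilon>\<^sub>0 * l2\<close> by \<open>l3\<close>,
      which is also \<open>b - w * m\<close>, so the factor \<open>1 - W + 2 * l2 * y^2\<close>
      remains; it equals \<open>l2 * y^2 - l1 * x^2\<close>.\<close>
    have "a * (- 2 * l1 * W + 8 * l1^2 * x^2) + \<epsilon>\<^sub>0 * (- 2 * l2 * W + 8 * l2^2 * y^2)
      = (b - w * m) - w * (m * c - d) * K * (W - 2 * l2 * y^2)"
      unfolding K_def k2 using k1 l3 W by algebra
    then show ?thesis
      using \<open>W \<noteq> 0\<close> by (simp add: divide_simps) algebra
  qed
  have second_eq: "(- 2 * K * l1 * y / W^2 + 8 * K * l1^2 * x^2 * y / W^3)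
      + (1 - m * c\<^sup>2) * (- 6 * K * l2 * y / W^2 + 8 * K * l2^2 * y^3 / W^3)
      = (m * c - d) * (- 4 * l2 * y / W^3)"
    if W: "W = l1 * x\<^sup>2 + l2 * y\<^sup>2 + 1" and "W \<noteq> 0" for x y W
  proof -
    \<comment> \<open>By \<open>l1_l2\<close> the left side is \<open>8 * K * l1 * y\<close> times
      \<open>l1 * x^2 + l2 * y^2 - W\<close>, and that last factor is \<open>-1\<close>. Then
      \<open>l2_l3\<close> evaluates \<open>K * l1\<close>.\<close>
    have "(- 2 * K * l1 * y * W + 8 * K * l1^2 * x^2 * y)
      + (1 - m * c\<^sup>2) * (- 6 * K * l2 * y * W + 8 * K * l2^2 * y^3)
      = (m * c - d) * (- 4 * l2 * y)"
      unfolding K_def using l1_l2 l2_l3 W by algebra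
    then show ?thesis
      using \<open>W \<noteq> 0\<close> by (simp add: divide_simps) algebra
  qed

  have "BR_ZR_solution_on D a b c \<epsilon>\<^sub>0 d m w \<psi> \<phi>"
    unfolding BR_ZR_solution_on_def
  proof (intro conjI ballI, goal_cases)
    case 1
    show ?case by fact
  next
    case 2
    show ?case
      by (rule has_partials_on_C2_on[OF \<open>open D\<close> psi psi_x psi_y psi_t])
  next
    case 3
    show ?case
      by (rule has_partials_on_C2_on[OF \<open>open D\<close> phi phi_x phi_y has_partials_on_zero])
  next
    case (4 p)
    obtain x y t where p: "p = (x, y, t)"
      by (cases p)
    with 4 have D: "(x, y, t) \<in> D"
      by simp
    have W: "\<Omega> x y = l1 * x\<^sup>2 + l2 * y\<^sup>2 + 1"
      by (simp add: \<open>\<Omega> = _\<close>)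
    have "(cmod (\<psi> x y t))\<^sup>2 = 1 / (\<Omega> x y)^2"
      using cmod_sq by meson
    \<comment> \<open>All time derivatives vanish. The first equation is then real, and
      \<open>complex_of_real\<close> carries \<open>first_eq\<close> over to the complex
      statement.\<close>
    then show ?case
      unfolding p prod.case transport_op_def cmod_sq vals[OF D]
      using arg_cong[OF first_eq[OF W nz[OF D]], of complex_of_real] second_eq[OF W nz[OF D]]
      by (simp add: \<psi>_eq)
  qed
  then show ?thesis
    unfolding D_def .
qed

end
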